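(* Let $\varphi\in ICPCC^s_{loc}(\mathcal A^k,C^*_{\mathcal E}(\mathcal D))$, $m=[\frac{k+1}{2}]$, and let $(\{\widetilde\pi_p\}_{p=1}^m,\widetilde V,\{\widetilde{\mathcal K};\widetilde{\mathcal F};\widetilde{\mathcal G}\})$ and $(\{\widehat\pi_p\}_{p=1}^m,\widehat V,\{\widehat{\mathcal K};\widehat{\mathcal F};\widehat{\mathcal G}\})$ be two minimal Stinespring triples for $\varphi$. Then there exists a unitary operator $U:\widetilde{\mathcal K}\to\widehat{\mathcal K}$ such that (1) $U\widetilde V=\widehat V$, and (2) for all $a_1,\dots,a_m\in\mathcal A$ and all $x\in\widetilde{\mathcal G}$, $Ux\in\widehat{\mathcal G}$ and $U\,\widetilde\pi_1(a_1)\cdots\widetilde\pi_m(a_m)x=\widehat\pi_1(a_1)\cdots\widehat\pi_m(a_m)\,Ux$.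
   Context: Locally $C^*$-algebras. A locally $C^*$-algebra is a $*$-algebra complete in the locally convex topology given by an upward filtered family of $C^*$-seminorms. Throughout, $\mathcal A$ is a unital locally $C^*$-algebra with upward filtered family of $C^*$-seminorms $\{p_\alpha:\alpha\in\Lambda\}$. For $\alpha\in\Lambda$ let $\mathcal A_\alpha=\mathcal A/\{a:p_\alpha(a)=0\}$ (a $C^*$-algebra with the norm induced by $p_\alpha$) and $\pi_\alpha:\mathcal A\to\mathcal A_\alpha$ the quotient map. For $a,b$ write $a=_\alpha b$ if $p_\alpha(a-b)=0$, and $a\ge_\alpha 0$ if $\pi_\alpha(a)\ge 0$ in $\mathcal A_\alpha$. For $n\in\mathbb N$, $M_n(\mathcal A)$ is a locally $C^*$-algebra with $C^*$-seminorms $p^n_\alpha$ (the norm of the image in $M_n(\mathcal A_\alpha)$), and the notations $=_\alpha,\ge_\alpha$ apply to it; the same conventions ($=_\ell$, $\ge_\ell$) apply to any locally $C^*$-algebra whose seminorms are indexed by $\ell$. Quantized domains. A quantized domain is a triple $\{\mathcal H;\mathcal E;\mathcal D\}$ where $\mathcal H$ is a Hilbert space, $\mathcal E=\{\mathcal H_\ell:\ell\in\Omega\}$ is a family of closed subspaces indexed by a directed set $\Omega$ with $\mathcal H_\ell\subseteq\mathcal H_{\ell'}$ whenever $\ell\le\ell'$, and $\mathcal D=\bigcup_{\ell}\mathcal H_\ell$ is dense in $\mathcal H$. With $P_\ell$ the orthogonal projection onto $\mathcal H_\ell$, $C^*_{\mathcal E}(\mathcal D)$ is the set of linear operators $T:\mathcal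 D\to\mathcal D$ with $TP_\ell=P_\ell TP_\ell$ and $P_\ell T\subseteq TP_\ell$ for all $\ell$, with $T|_{\mathcal H_\ell}$ bounded; it is a unital locally $C^*$-algebra with involution $T^*:=T^{\bigstar}|_{\mathcal D}$ ($T^\bigstar$ the Hilbert space adjoint) and $C^*$-seminorms $\|T\|_\ell=\|T|_{\mathcal H_\ell}\|$, $\ell\in\Omega$. $M_n(C^*_{\mathcal E}(\mathcal D))$ is identified with $C^*_{\mathcal E^n}(\mathcal D^n)$ for the quantized domain $\{\mathcal H^n;\{\mathcal H_\ell^n\};\mathcal D^n\}$ (n-fold direct sums). Throughout, $\{\mathcal H;\mathcal E;\mathcal D\}$ with $\mathcal E=\{\mathcal H_\ell:\ell\in\Omega\}$ is a fixed quantized domain. A unital $*$-homomorphism $\pi:\mathcal A\to C^*_{\mathcal F}(\mathcal G)$, for a quantized domain $\{\mathcal K;\mathcal F;\mathcal G\}$ with $\mathcal F=\{\mathcal K_\ell:\ell\in\Omega\}$, is local contractive if for each $\ell\in\Omega$ there is $\alpha\in\Lambda$ with $\|\pi(a)\|_\ell\le p_\alpha(a)$ for all $a\in\mathcal A$. Multilinear maps. Let $k\ge 1$ and $m=[\frac{k+1}{2}]$. For a $k$-linear map $\varphi:\mathcal A^k\to\mathcal B$, $\mathcal B=C^*_{\mathcal E}(\mathcal D)$ with seminorms $q_\ell=\|\cdot\|_\ell$, its amplification $\varphi_n:M_n(\mathcal A)^k\to M_n(\mathcal B)$ is $\varphi_n(A_1,\dots,A_k)=\big[\sum_{r_1,\dots,r_{k-1}=1}^n\varphi(a_{1,ir_1},a_{2,r_1r_2},\dots,a_{k,r_{k-1}j})\big]_{i,j=1}^n$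 for $A_t=[a_{t,ij}]$. $\varphi$ is symmetric if $\varphi(a_1,\dots,a_k)^*=\varphi(a_k^*,\dots,a_1^* )$ for all $a_i$. $\varphi$ is invariant if, for $k=2m-1$, $\varphi(a_1c_1,\dots,a_{m-1}c_{m-1},a_m,a_{m+1},\dots,a_{2m-1})=\varphi(a_1,\dots,a_{m-1},a_m,c_{m-1}a_{m+1},\dots,c_1a_{2m-1})$, and for $k=2m$, $\varphi(a_1c_1,\dots,a_mc_m,a_{m+1},\dots,a_{2m})=\varphi(a_1,\dots,a_m,c_ma_{m+1},\dots,c_1a_{2m})$, for all $a_i,c_j\in\mathcal A$. $\varphi$ is local completely contractive if for each $\ell\in\Omega$ there is $\alpha_\ell\in\Lambda$ such that for all $n$ and $A_1,\dots,A_k\in M_n(\mathcal A)$, $q^n_\ell(\varphi_n(A_1,\dots,A_k))\le\max_i p^n_{\alpha_\ell}(A_i)$. $\varphi$ is local completely positive if for each $\ell\in\Omega$ there is $\alpha_\ell\in\Lambda$ such that for all $n$ and $A_1,\dots,A_k\in M_n(\mathcal A)$: $\varphi_n(A_1,\dots,A_k)\ge_\ell 0$ whenever $A_p^*=_{\alpha_\ell}A_{k+1-p}$ for $p=1,\dots,m$ and, if $k$ is odd, additionally $A_m\ge_{\alpha_\ell}0$; and $\varphi_n(A_1,\dots,A_k)=_\ell 0$ whenever $A_i=_{\alpha_\ell}0$ for some $i$. $ICPCC^s_{loc}(\mathcal A^k,\mathcal B)$ denotes the set of symmetric, invariant, local completely contractive and local completely positive $k$-linear maps $\mathcal A^k\to\mathcal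 B$. Stinespring triples. For $\varphi\in ICPCC^s_{loc}(\mathcal A^k,C^*_{\mathcal E}(\mathcal D))$, a Stinespring triple for $\varphi$ is $(\{\pi_p\}_{p=1}^m,V,\{\mathcal K;\mathcal F;\mathcal G\})$ where $\{\mathcal K;\mathcal F;\mathcal G\}$ is a quantized domain with $\mathcal F=\{\mathcal K_\ell:\ell\in\Omega\}$ (same index set $\Omega$), $V\in\mathcal B(\mathcal H,\mathcal K)$ is a contraction with $V(\mathcal H_\ell)\subseteq\mathcal K_\ell$ for all $\ell$, $\pi_1,\dots,\pi_m:\mathcal A\to C^*_{\mathcal F}(\mathcal G)$ are pairwise commuting unital local contractive $*$-homomorphisms, and for all $a_1,\dots,a_k\in\mathcal A$ and $h\in\mathcal D$: if $k=2m-1$, $\varphi(a_1,\dots,a_k)h=V^*\pi_1(a_m)\pi_2(a_{m-1}a_{m+1})\cdots\pi_m(a_1a_{2m-1})Vh$; if $k=2m$, $\varphi(a_1,\dots,a_k)h=V^*\pi_1(a_ma_{m+1})\pi_2(a_{m-1}a_{m+2})\cdots\pi_m(a_1a_{2m})Vh$. The triple is minimal if $\mathcal K_\ell=\overline{\operatorname{span}}\{\pi_1(a_1)\cdots\pi_m(a_m)Vh:a_p\in\mathcal A,\ h\in\mathcal H_\ell\}$ for every $\ell\in\Omega$. *)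

theory Defs
  imports "HOL-Analysis.Analysis"
begin

section \<open>Complex vector spaces, complex *-algebras, complex Hilbert spaces\<close>

class complex_vector_space = ab_group_add +
  fixes scaleC :: "complex \<Rightarrow> 'a \<Rightarrow> 'a"  (infixr \<open>*\<^sub>C\<close> 75)
  assumes scaleC_add_right: "a *\<^sub>C (x + y) = a *\<^sub>C x + a *\<^sub>C y"
    and scaleC_add_left: "(a + b) *\<^sub>C x = a *\<^sub>C x + b *\<^sub>C x"
    and scaleC_scaleC: "a *\<^sub>C (b *\<^sub>C x) = (a * b) *\<^sub>C x"
    and scaleC_one: "1 *\<^sub>C x = x"

text \<open>Unital complex *-algebras (the underlying algebra of a unital locally C*-algebra).\<close>
class complex_star_algebra = ring_1 + complex_vector_space +
  fixes cstar :: "'a \<Rightarrow> 'a"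
  assumes mult_scaleC_left: "(c *\<^sub>C x) * y = c *\<^sub>C (x * y)"
    and mult_scaleC_right: "x * (c *\<^sub>C y) = c *\<^sub>C (x * y)"
    and cstar_cstar: "cstar (cstar x) = x"
    and cstar_add: "cstar (x + y) = cstar x + cstar y"
    and cstar_scaleC: "cstar (c *\<^sub>C x) = cnj c *\<^sub>C cstar x"
    and cstar_mult: "cstar (x * y) = cstar y * cstar x"

text \<open>Complex Hilbert spaces; the inner product is linear in the first argument.\<close>
class complex_hilbert_space = complex_vector_space +
  fixes cinner :: "'a \<Rightarrow> 'a \<Rightarrow> complex"
  assumes cinner_add_left: "cinner (x + y) z = cinner x z + cinner y z"
    and cinner_scaleC_left: "cinner (c *\<^sub>C x) y = c * cinner x y"
    and cinner_commute: "cinner y x = cnj (cinner x y)"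
    and cinner_nonneg: "0 \<le> Re (cinner x x)"
    and cinner_eq_zero: "cinner x x = 0 \<Longrightarrow> x = 0"
    and cinner_complete:
      "(\<forall>e>0. \<exists>N::nat. \<forall>i\<ge>N. \<forall>j\<ge>N. sqrt (Re (cinner (X i - X j) (X i - X j))) < e) \<Longrightarrow>
       \<exists>L. \<forall>e>0. \<exists>N::nat. \<forall>i\<ge>N. sqrt (Re (cinner (X i - L) (X i - L))) < e"

definition cnorm :: "'h::complex_hilbert_space \<Rightarrow> real" where
  "cnorm x = sqrt (Re (cinner x x))"

definition closure_C :: "'h::complex_hilbert_space set \<Rightarrow> 'h set" where
  "closure_C S = {x. \<forall>e>0. \<exists>y\<in>S. cnorm (x - y) < e}"

definition lin_span_C :: "'h::complex_vector_space set \<Rightarrow> 'h set" where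
  "lin_span_C S = {x. \<exists>(n::nat) c v. (\<forall>i<n. v i \<in> S) \<and> x = (\<Sum>i<n. c i *\<^sub>C v i)}"

definition closed_subspace :: "'h::complex_hilbert_space set \<Rightarrow> bool" where
  "closed_subspace S \<longleftrightarrow> 0 \<in> S \<and> (\<forall>x\<in>S. \<forall>y\<in>S. x + y \<in> S)
     \<and> (\<forall>c. \<forall>x\<in>S. c *\<^sub>C x \<in> S) \<and> closure_C S \<subseteq> S"

text \<open>Orthogonal projection onto a closed subspace.\<close>
definition orth_proj :: "'h::complex_hilbert_space set \<Rightarrow> 'h \<Rightarrow> 'h" where
  "orth_proj S x = (THE y. y \<in> S \<and> (\<forall>z\<in>S. cinner (x - y) z = 0))"

definition clinear_on :: "'h::complex_vector_space set \<Rightarrow> ('h \<Rightarrow> 'k::complex_vector_space) \<Rightarrow> bool" where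
  "clinear_on S f \<longleftrightarrow> (\<forall>x\<in>S. \<forall>y\<in>S. f (x + y) = f x + f y) \<and> (\<forall>c. \<forall>x\<in>S. f (c *\<^sub>C x) = c *\<^sub>C f x)"

text \<open>A unitary operator: a surjective linear map preserving inner products.\<close>
definition cunitary :: "('h::complex_hilbert_space \<Rightarrow> 'k::complex_hilbert_space) \<Rightarrow> bool" where
  "cunitary U \<longleftrightarrow> clinear_on UNIV U \<and> (\<forall>x y. cinner (U x) (U y) = cinner x y) \<and> surj U"

text \<open>Operator seminorm of T restricted to S: sup of |Tx| over the unit ball of S.\<close>
definition op_seminorm :: "'h::complex_hilbert_space set \<Rightarrow> ('h \<Rightarrow> 'h) \<Rightarrow> real" where
  "op_seminorm S T = Sup ((\<lambda>x. cnorm (T x)) ` {x\<in>S. cnorm x \<le> 1})"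

text \<open>S is (the restriction to D of) the Hilbert space adjoint of T, both defined on the dense set D.\<close>
definition op_adjoint_on :: "'h::complex_hilbert_space set \<Rightarrow> ('h \<Rightarrow> 'h) \<Rightarrow> ('h \<Rightarrow> 'h) \<Rightarrow> bool" where
  "op_adjoint_on D T S \<longleftrightarrow> (\<forall>x\<in>D. \<forall>y\<in>D. cinner (T y) x = cinner y (S x))"

section \<open>Quantized domains and the locally C*-algebra C*_E(D)\<close>

definition qdom :: "'o set \<Rightarrow> ('o \<Rightarrow> 'h set) \<Rightarrow> 'h set" where
  "qdom Om E = (\<Union>l\<in>Om. E l)"

text \<open>(Om, le) is a directed set, E l are closed subspaces increasing along le, and their union is dense.\<close>
definition quantized_domain :: "'o set \<Rightarrow> ('o \<Rightarrow> 'o \<Rightarrow> bool) \<Rightarrow> ('o \<Rightarrow> 'h::complex_hilbert_space set) \<Rightarrow> bool" where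
  "quantized_domain Om le E \<longleftrightarrow> Om \<noteq> {}
     \<and> (\<forall>l\<in>Om. le l l)
     \<and> (\<forall>l1\<in>Om. \<forall>l2\<in>Om. \<forall>l3\<in>Om. le l1 l2 \<and> le l2 l3 \<longrightarrow> le l1 l3)
     \<and> (\<forall>l1\<in>Om. \<forall>l2\<in>Om. \<exists>l3\<in>Om. le l1 l3 \<and> le l2 l3)
     \<and> (\<forall>l\<in>Om. closed_subspace (E l))
     \<and> (\<forall>l\<in>Om. \<forall>l'\<in>Om. le l l' \<longrightarrow> E l \<subseteq> E l')
     \<and> closure_C (qdom Om E) = UNIV"

text \<open>Operators T : D -> D (represented by functions, only their values on D matter).\<close>
definition cstar_ED :: "'o set \<Rightarrow> ('o \<Rightarrow> 'h::complex_hilbert_space set) \<Rightarrow> ('h \<Rightarrow> 'h) set" where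
  "cstar_ED Om E = {T. (\<forall>x\<in>qdom Om E. T x \<in> qdom Om E) \<and> clinear_on (qdom Om E) T
     \<and> (\<forall>l\<in>Om. \<forall>x. T (orth_proj (E l) x) = orth_proj (E l) (T (orth_proj (E l) x)))
     \<and> (\<forall>l\<in>Om. \<forall>x\<in>qdom Om E. orth_proj (E l) (T x) = T (orth_proj (E l) x))
     \<and> (\<forall>l\<in>Om. \<exists>C. \<forall>x\<in>E l. cnorm (T x) \<le> C * cnorm x)}"

section \<open>C*-seminorms and locally C*-algebras\<close>

definition cstar_seminorm_on ::
  "'b set \<Rightarrow> ('b \<Rightarrow> 'b \<Rightarrow> 'b) \<Rightarrow> (complex \<Rightarrow> 'b \<Rightarrow> 'b) \<Rightarrow> ('b \<Rightarrow> 'b \<Rightarrow> 'b) \<Rightarrow> ('b \<Rightarrow> 'b) \<Rightarrow> ('b \<Rightarrow> real) \<Rightarrow> bool" where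
  "cstar_seminorm_on S add sc mul st q \<longleftrightarrow>
     (\<forall>x\<in>S. \<forall>y\<in>S. q (add x y) \<le> q x + q y)
   \<and> (\<forall>c. \<forall>x\<in>S. q (sc c x) = cmod c * q x)
   \<and> (\<forall>x\<in>S. \<forall>y\<in>S. q (mul x y) \<le> q x * q y)
   \<and> (\<forall>x\<in>S. q (mul (st x) x) = (q x)\<^sup>2)"

text \<open>A (unital) locally C*-algebra: Hausdorff, complete (for Cauchy filters/nets), with an upward
  filtered family of C*-seminorms indexed by Lam.\<close>
definition locally_cstar :: "'i set \<Rightarrow> ('i \<Rightarrow> 'a::complex_star_algebra \<Rightarrow> real) \<Rightarrow> bool" where
  "locally_cstar Lam p \<longleftrightarrow> Lam \<noteq> {}
     \<and> (\<forall>\<alpha>\<in>Lam. cstar_seminorm_on UNIV (+) (*\<^sub>C) (*) cstar (p \<alpha>))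
     \<and> (\<forall>\<alpha>\<in>Lam. \<forall>\<beta>\<in>Lam. \<exists>\<gamma>\<in>Lam. \<forall>a. p \<alpha> a \<le> p \<gamma> a \<and> p \<beta> a \<le> p \<gamma> a)
     \<and> (\<forall>a. (\<forall>\<alpha>\<in>Lam. p \<alpha> a = 0) \<longrightarrow> a = 0)
     \<and> (\<forall>F. F \<noteq> bot \<and> (\<forall>\<alpha>\<in>Lam. \<forall>e>0. eventually (\<lambda>(x, y). p \<alpha> (x - y) < e) (F \<times>\<^sub>F F))
           \<longrightarrow> (\<exists>a. \<forall>\<alpha>\<in>Lam. \<forall>e>0. eventually (\<lambda>x. p \<alpha> (x - a) < e) F))"

section \<open>Matrices over A: M_n(A), represented by nat => nat => 'a, zero outside n x n\<close>

definition mat_set :: "nat \<Rightarrow> (nat \<Rightarrow> nat \<Rightarrow> 'a::zero) set" where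
  "mat_set n = {X. \<forall>i j. \<not> (i < n \<and> j < n) \<longrightarrow> X i j = 0}"

definition mat_add :: "nat \<Rightarrow> (nat \<Rightarrow> nat \<Rightarrow> 'a::complex_star_algebra) \<Rightarrow> (nat \<Rightarrow> nat \<Rightarrow> 'a) \<Rightarrow> (nat \<Rightarrow> nat \<Rightarrow> 'a)" where
  "mat_add n X Y = (\<lambda>i j. if i < n \<and> j < n then X i j + Y i j else 0)"

definition mat_diff :: "nat \<Rightarrow> (nat \<Rightarrow> nat \<Rightarrow> 'a::complex_star_algebra) \<Rightarrow> (nat \<Rightarrow> nat \<Rightarrow> 'a) \<Rightarrow> (nat \<Rightarrow> nat \<Rightarrow> 'a)" where
  "mat_diff n X Y = (\<lambda>i j. if i < n \<and> j < n then X i j - Y i j else 0)"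

definition mat_scale :: "nat \<Rightarrow> complex \<Rightarrow> (nat \<Rightarrow> nat \<Rightarrow> 'a::complex_star_algebra) \<Rightarrow> (nat \<Rightarrow> nat \<Rightarrow> 'a)" where
  "mat_scale n c X = (\<lambda>i j. if i < n \<and> j < n then c *\<^sub>C X i j else 0)"

definition mat_mult :: "nat \<Rightarrow> (nat \<Rightarrow> nat \<Rightarrow> 'a::complex_star_algebra) \<Rightarrow> (nat \<Rightarrow> nat \<Rightarrow> 'a) \<Rightarrow> (nat \<Rightarrow> nat \<Rightarrow> 'a)" where
  "mat_mult n X Y = (\<lambda>i j. if i < n \<and> j < n then (\<Sum>r<n. X i r * Y r j) else 0)"

definition mat_star :: "nat \<Rightarrow> (nat \<Rightarrow> nat \<Rightarrow> 'a::complex_star_algebra) \<Rightarrow> (nat \<Rightarrow> nat \<Rightarrow> 'a)" where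
  "mat_star n X = (\<lambda>i j. if i < n \<and> j < n then cstar (X j i) else 0)"

text \<open>p^n_alpha: the norm of the image in the C*-algebra M_n(A_alpha). It is the unique C*-seminorm on
  M_n(A) whose kernel consists of the matrices with all entries in ker p_alpha (uniqueness of C*-norms
  on the C*-algebra M_n(A_alpha)); it is set to 0 outside M_n(A).\<close>
definition mat_seminorm :: "('i \<Rightarrow> 'a::complex_star_algebra \<Rightarrow> real) \<Rightarrow> 'i \<Rightarrow> nat \<Rightarrow> (nat \<Rightarrow> nat \<Rightarrow> 'a) \<Rightarrow> real" where
  "mat_seminorm p \<alpha> n = (THE q. cstar_seminorm_on (mat_set n) (mat_add n) (mat_scale n) (mat_mult n) (mat_star n) q
       \<and> (\<forall>X\<in>mat_set n. q X = 0 \<longleftrightarrow> (\<forall>i<n. \<forall>j<n. p \<alpha> (X i j) = 0))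
       \<and> (\<forall>X. X \<notin> mat_set n \<longrightarrow> q X = 0))"

text \<open>X =_alpha Y in M_n(A)\<close>
definition mat_eq_at :: "('i \<Rightarrow> 'a::complex_star_algebra \<Rightarrow> real) \<Rightarrow> 'i \<Rightarrow> nat \<Rightarrow> (nat \<Rightarrow> nat \<Rightarrow> 'a) \<Rightarrow> (nat \<Rightarrow> nat \<Rightarrow> 'a) \<Rightarrow> bool" where
  "mat_eq_at p \<alpha> n X Y \<longleftrightarrow> mat_seminorm p \<alpha> n (mat_diff n X Y) = 0"

text \<open>X >=_alpha 0 in M_n(A): the image of X in the C*-algebra M_n(A_alpha) is positive, i.e. of the
  form Z* Z with Z in M_n(A_alpha) (every element of M_n(A_alpha) is the image of some B in M_n(A)).\<close>
definition mat_pos_at :: "('i \<Rightarrow> 'a::complex_star_algebra \<Rightarrow> real) \<Rightarrow> 'i \<Rightarrow> nat \<Rightarrow> (nat \<Rightarrow> nat \<Rightarrow> 'a) \<Rightarrow> bool" where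
  "mat_pos_at p \<alpha> n X \<longleftrightarrow> (\<exists>B\<in>mat_set n. mat_eq_at p \<alpha> n X (mat_mult n (mat_star n B) B))"

section \<open>Matrices over C*_E(D) = C*_{E^n}(D^n)\<close>

definition vecs_in :: "nat \<Rightarrow> 'h::complex_hilbert_space set \<Rightarrow> (nat \<Rightarrow> 'h) set" where
  "vecs_in n S = {v. (\<forall>i<n. v i \<in> S) \<and> (\<forall>i\<ge>n. v i = 0)}"

definition vnorm :: "nat \<Rightarrow> (nat \<Rightarrow> 'h::complex_hilbert_space) \<Rightarrow> real" where
  "vnorm n v = sqrt (\<Sum>i<n. (cnorm (v i))\<^sup>2)"

definition opmat_apply :: "nat \<Rightarrow> (nat \<Rightarrow> nat \<Rightarrow> ('h::complex_hilbert_space \<Rightarrow> 'h)) \<Rightarrow> (nat \<Rightarrow> 'h) \<Rightarrow> (nat \<Rightarrow> 'h)" where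
  "opmat_apply n Y v = (\<lambda>i. if i < n then (\<Sum>j<n. Y i j (v j)) else 0)"

text \<open>q^n_l(Y): norm of Y restricted to H_l^n.\<close>
definition opmat_seminorm :: "'h::complex_hilbert_space set \<Rightarrow> nat \<Rightarrow> (nat \<Rightarrow> nat \<Rightarrow> ('h \<Rightarrow> 'h)) \<Rightarrow> real" where
  "opmat_seminorm S n Y = Sup ((\<lambda>v. vnorm n (opmat_apply n Y v)) ` {v\<in>vecs_in n S. vnorm n v \<le> 1})"

text \<open>Y >=_l 0: Y restricted to H_l^n is a positive operator on the Hilbert space H_l^n.\<close>
definition opmat_pos :: "'h::complex_hilbert_space set \<Rightarrow> nat \<Rightarrow> (nat \<Rightarrow> nat \<Rightarrow> ('h \<Rightarrow> 'h)) \<Rightarrow> bool" where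
  "opmat_pos S n Y \<longleftrightarrow> (\<forall>v\<in>vecs_in n S. \<exists>r\<ge>0. (\<Sum>i<n. cinner (opmat_apply n Y v i) (v i)) = complex_of_real r)"

section \<open>Multilinear maps (arguments indexed by 1..k)\<close>

text \<open>Amplification phi_n; Am t is the t-th matrix argument A_t.\<close>
definition amplify :: "nat \<Rightarrow> nat \<Rightarrow> ((nat \<Rightarrow> 'a::complex_star_algebra) \<Rightarrow> 'h::complex_hilbert_space \<Rightarrow> 'h)
    \<Rightarrow> (nat \<Rightarrow> nat \<Rightarrow> nat \<Rightarrow> 'a) \<Rightarrow> (nat \<Rightarrow> nat \<Rightarrow> ('h \<Rightarrow> 'h))" where
  "amplify k n \<phi> Am = (\<lambda>i j x. if i < n \<and> j < n then
      (\<Sum>r\<in>PiE {1..k-1} (\<lambda>_. {..<n}).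
          \<phi> (\<lambda>t. Am t ((r(0 := i, k := j)) (t - 1)) ((r(0 := i, k := j)) t)) x)
      else 0)"

definition k_linear_into :: "'o set \<Rightarrow> ('o \<Rightarrow> 'h::complex_hilbert_space set) \<Rightarrow> nat
    \<Rightarrow> ((nat \<Rightarrow> 'a::complex_star_algebra) \<Rightarrow> 'h \<Rightarrow> 'h) \<Rightarrow> bool" where
  "k_linear_into Om E k \<phi> \<longleftrightarrow>
     (\<forall>a. \<phi> a \<in> cstar_ED Om E)
   \<and> (\<forall>a b. (\<forall>t\<in>{1..k}. a t = b t) \<longrightarrow> (\<forall>x\<in>qdom Om E. \<phi> a x = \<phi> b x))
   \<and> (\<forall>a t y z. t \<in> {1..k} \<longrightarrow>
        (\<forall>x\<in>qdom Om E. \<phi> (a(t := y + z)) x = \<phi> (a(t := y)) x + \<phi> (a(t := z)) x))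
   \<and> (\<forall>a t c y. t \<in> {1..k} \<longrightarrow>
        (\<forall>x\<in>qdom Om E. \<phi> (a(t := c *\<^sub>C y)) x = c *\<^sub>C \<phi> (a(t := y)) x))"

definition ml_symmetric :: "'o set \<Rightarrow> ('o \<Rightarrow> 'h::complex_hilbert_space set) \<Rightarrow> nat
    \<Rightarrow> ((nat \<Rightarrow> 'a::complex_star_algebra) \<Rightarrow> 'h \<Rightarrow> 'h) \<Rightarrow> bool" where
  "ml_symmetric Om E k \<phi> \<longleftrightarrow>
     (\<forall>a. op_adjoint_on (qdom Om E) (\<phi> a) (\<phi> (\<lambda>i. cstar (a (k + 1 - i)))))"

text \<open>Invariance, uniformly for k = 2m-1 and k = 2m: with j = k div 2 (= m-1 resp. m),
  phi(a_1 c_1, ..., a_j c_j, a_{j+1}, ..., a_k) = phi(a_1, ..., a_{k-j}, c_j a_{k+1-j}, ..., c_1 a_k).\<close>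
definition ml_invariant :: "'o set \<Rightarrow> ('o \<Rightarrow> 'h::complex_hilbert_space set) \<Rightarrow> nat
    \<Rightarrow> ((nat \<Rightarrow> 'a::complex_star_algebra) \<Rightarrow> 'h \<Rightarrow> 'h) \<Rightarrow> bool" where
  "ml_invariant Om E k \<phi> \<longleftrightarrow>
     (\<forall>a c. \<forall>x\<in>qdom Om E.
        \<phi> (\<lambda>i. if 1 \<le> i \<and> i \<le> k div 2 then a i * c i else a i) x
      = \<phi> (\<lambda>i. if k + 1 - k div 2 \<le> i \<and> i \<le> k then c (k + 1 - i) * a i else a i) x)"

definition local_cc :: "'i set \<Rightarrow> ('i \<Rightarrow> 'a::complex_star_algebra \<Rightarrow> real) \<Rightarrow> 'o set
    \<Rightarrow> ('o \<Rightarrow> 'h::complex_hilbert_space set) \<Rightarrow> nat \<Rightarrow> ((nat \<Rightarrow> 'a) \<Rightarrow> 'h \<Rightarrow> 'h) \<Rightarrow> bool" where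
  "local_cc Lam p Om E k \<phi> \<longleftrightarrow>
     (\<forall>l\<in>Om. \<exists>\<alpha>\<in>Lam. \<forall>n>0. \<forall>Am. (\<forall>t\<in>{1..k}. Am t \<in> mat_set n) \<longrightarrow>
        opmat_seminorm (E l) n (amplify k n \<phi> Am) \<le> Max ((\<lambda>t. mat_seminorm p \<alpha> n (Am t)) ` {1..k}))"

definition local_cp :: "'i set \<Rightarrow> ('i \<Rightarrow> 'a::complex_star_algebra \<Rightarrow> real) \<Rightarrow> 'o set
    \<Rightarrow> ('o \<Rightarrow> 'h::complex_hilbert_space set) \<Rightarrow> nat \<Rightarrow> ((nat \<Rightarrow> 'a) \<Rightarrow> 'h \<Rightarrow> 'h) \<Rightarrow> bool" where
  "local_cp Lam p Om E k \<phi> \<longleftrightarrow>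
     (\<forall>l\<in>Om. \<exists>\<alpha>\<in>Lam. \<forall>n>0. \<forall>Am. (\<forall>t\<in>{1..k}. Am t \<in> mat_set n) \<longrightarrow>
        (((\<forall>q\<in>{1..(k + 1) div 2}. mat_eq_at p \<alpha> n (mat_star n (Am q)) (Am (k + 1 - q)))
           \<and> (odd k \<longrightarrow> mat_pos_at p \<alpha> n (Am ((k + 1) div 2))))
          \<longrightarrow> opmat_pos (E l) n (amplify k n \<phi> Am))
      \<and> ((\<exists>i\<in>{1..k}. mat_eq_at p \<alpha> n (Am i) (\<lambda>_ _. 0))
          \<longrightarrow> opmat_seminorm (E l) n (amplify k n \<phi> Am) = 0))"

text \<open>ICPCC^s_loc(A^k, C*_E(D))\<close>
definition ICPCC_s_loc :: "'i set \<Rightarrow> ('i \<Rightarrow> 'a::complex_star_algebra \<Rightarrow> real) \<Rightarrow> 'o set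
    \<Rightarrow> ('o \<Rightarrow> 'h::complex_hilbert_space set) \<Rightarrow> nat \<Rightarrow> ((nat \<Rightarrow> 'a) \<Rightarrow> 'h \<Rightarrow> 'h) \<Rightarrow> bool" where
  "ICPCC_s_loc Lam p Om E k \<phi> \<longleftrightarrow> k_linear_into Om E k \<phi> \<and> ml_symmetric Om E k \<phi>
     \<and> ml_invariant Om E k \<phi> \<and> local_cc Lam p Om E k \<phi> \<and> local_cp Lam p Om E k \<phi>"

section \<open>Stinespring triples\<close>

text \<open>Unital local contractive *-homomorphism A -> C*_F(G).\<close>
definition local_contr_star_hom :: "'i set \<Rightarrow> ('i \<Rightarrow> 'a::complex_star_algebra \<Rightarrow> real) \<Rightarrow> 'o set
    \<Rightarrow> ('o \<Rightarrow> 'k::complex_hilbert_space set) \<Rightarrow> ('a \<Rightarrow> 'k \<Rightarrow> 'k) \<Rightarrow> bool" where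
  "local_contr_star_hom Lam p Om F \<pi> \<longleftrightarrow>
     (\<forall>a. \<pi> a \<in> cstar_ED Om F)
   \<and> (\<forall>a b. \<forall>x\<in>qdom Om F. \<pi> (a + b) x = \<pi> a x + \<pi> b x)
   \<and> (\<forall>c a. \<forall>x\<in>qdom Om F. \<pi> (c *\<^sub>C a) x = c *\<^sub>C \<pi> a x)
   \<and> (\<forall>a b. \<forall>x\<in>qdom Om F. \<pi> (a * b) x = \<pi> a (\<pi> b x))
   \<and> (\<forall>x\<in>qdom Om F. \<pi> 1 x = x)
   \<and> (\<forall>a. op_adjoint_on (qdom Om F) (\<pi> a) (\<pi> (cstar a)))
   \<and> (\<forall>l\<in>Om. \<exists>\<alpha>\<in>Lam. \<forall>a. op_seminorm (F l) (\<pi> a) \<le> p \<alpha> a)"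

text \<open>pi_prod pi b j x = pi_1(b_1) pi_2(b_2) ... pi_j(b_j) x\<close>
primrec pi_prod :: "(nat \<Rightarrow> 'a \<Rightarrow> 'k \<Rightarrow> 'k) \<Rightarrow> (nat \<Rightarrow> 'a) \<Rightarrow> nat \<Rightarrow> 'k \<Rightarrow> 'k" where
  "pi_prod \<pi> b 0 x = x"
| "pi_prod \<pi> b (Suc j) x = pi_prod \<pi> b j (\<pi> (Suc j) (b (Suc j)) x)"

text \<open>Arguments of pi_1, ..., pi_m in the Stinespring formula (m = (k+1) div 2):
  k = 2m-1: a_m, a_{m-1} a_{m+1}, ..., a_1 a_{2m-1};  k = 2m: a_m a_{m+1}, ..., a_1 a_{2m}.\<close>
definition stine_args :: "nat \<Rightarrow> (nat \<Rightarrow> 'a::complex_star_algebra) \<Rightarrow> nat \<Rightarrow> 'a" where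
  "stine_args k a = (\<lambda>q. let m = (k + 1) div 2 in
     if odd k then (if q = 1 then a m else a (m + 1 - q) * a (m - 1 + q))
     else a (m + 1 - q) * a (m + q))"

text \<open>The formula phi(a)h = V^* pi_1(..)...pi_m(..) V h is expressed through the defining property of
  the Hilbert space adjoint V^* of the bounded operator V: <V^* y, z> = <y, V z>.\<close>
definition stinespring_triple :: "'i set \<Rightarrow> ('i \<Rightarrow> 'a::complex_star_algebra \<Rightarrow> real) \<Rightarrow> 'o set
    \<Rightarrow> ('o \<Rightarrow> 'o \<Rightarrow> bool) \<Rightarrow> ('o \<Rightarrow> 'h::complex_hilbert_space set) \<Rightarrow> nat \<Rightarrow> ((nat \<Rightarrow> 'a) \<Rightarrow> 'h \<Rightarrow> 'h)
    \<Rightarrow> (nat \<Rightarrow> 'a \<Rightarrow> 'k::complex_hilbert_space \<Rightarrow> 'k) \<Rightarrow> ('h \<Rightarrow> 'k) \<Rightarrow> ('o \<Rightarrow> 'k set) \<Rightarrow> bool" where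
  "stinespring_triple Lam p Om le E k \<phi> \<pi> V F \<longleftrightarrow>
     quantized_domain Om le F
   \<and> clinear_on UNIV V \<and> (\<forall>x. cnorm (V x) \<le> cnorm x)
   \<and> (\<forall>l\<in>Om. V ` E l \<subseteq> F l)
   \<and> (\<forall>q\<in>{1..(k + 1) div 2}. local_contr_star_hom Lam p Om F (\<pi> q))
   \<and> (\<forall>q\<in>{1..(k + 1) div 2}. \<forall>q'\<in>{1..(k + 1) div 2}. q \<noteq> q' \<longrightarrow>
        (\<forall>a b. \<forall>x\<in>qdom Om F. \<pi> q a (\<pi> q' b x) = \<pi> q' b (\<pi> q a x)))
   \<and> (\<forall>a. \<forall>h\<in>qdom Om E. \<forall>z.
        cinner (\<phi> a h) z = cinner (pi_prod \<pi> (stine_args k a) ((k + 1) div 2) (V h)) (V z))"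

definition minimal_stinespring_triple :: "'i set \<Rightarrow> ('i \<Rightarrow> 'a::complex_star_algebra \<Rightarrow> real) \<Rightarrow> 'o set
    \<Rightarrow> ('o \<Rightarrow> 'o \<Rightarrow> bool) \<Rightarrow> ('o \<Rightarrow> 'h::complex_hilbert_space set) \<Rightarrow> nat \<Rightarrow> ((nat \<Rightarrow> 'a) \<Rightarrow> 'h \<Rightarrow> 'h)
    \<Rightarrow> (nat \<Rightarrow> 'a \<Rightarrow> 'k::complex_hilbert_space \<Rightarrow> 'k) \<Rightarrow> ('h \<Rightarrow> 'k) \<Rightarrow> ('o \<Rightarrow> 'k set) \<Rightarrow> bool" where
  "minimal_stinespring_triple Lam p Om le E k \<phi> \<pi> V F \<longleftrightarrow>
     stinespring_triple Lam p Om le E k \<phi> \<pi> V F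
   \<and> (\<forall>l\<in>Om. F l = closure_C (lin_span_C {pi_prod \<pi> b ((k + 1) div 2) (V h) | b h. h \<in> E l}))"

end

theory Submission
  imports Defs
begin

text \<open>The vectors \<^term>\<open>pi_prod \<pi> b m (V h)\<close> are total in each dilation space, and moving all
  representations to one side of the inner product by commutativity, the Stinespring formula
  expresses their Gram matrix through \<open>\<phi>\<close> alone. Two total families with the same Gram matrix
  are related by a unitary \<open>U\<close>. Both identities claimed for \<open>U\<close> are checked by pairing with the
  total family of the second triple; since the representations are *-preserving, no boundedness
  of the represented operators enters.\<close>

section \<open>Complex Hilbert spaces\<close>

lemma scaleC_zero_left [simp]: "0 *\<^sub>C (x::'a::complex_vector_space) = 0"
  using scaleC_add_left[of 0 0 x] by simp

lemma scaleC_minus_one: "(-1) *\<^sub>C (x::'a::complex_vector_space) = - x"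
proof -
  have "(-1) *\<^sub>C x + x = 0"
    using scaleC_add_left[of "-1" 1 x] by (simp add: scaleC_one)
  then show ?thesis
    by (simp add: eq_neg_iff_add_eq_0)
qed

context
  fixes x y z :: "'h::complex_hilbert_space"
begin

lemma cinner_add_right: "cinner x (y + z) = cinner x y + cinner x z"
  by (metis cinner_add_left cinner_commute complex_cnj_add)

lemma cinner_scaleC_right: "cinner x (c *\<^sub>C y) = cnj c * cinner x y"
  by (metis cinner_commute cinner_scaleC_left complex_cnj_mult)

lemma cinner_zero_left [simp]: "cinner 0 y = 0"
  using cinner_scaleC_left[of 0 0 y] by simp

lemma cinner_zero_right [simp]: "cinner x 0 = 0"
  using cinner_scaleC_right[of 0] by (metis cinner_commute cinner_scaleC_left complex_cnj_zero
      mult_zero_left scaleC_zero_left)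

lemma cinner_minus_left: "cinner (- x) y = - cinner x y"
  using cinner_scaleC_left[of "-1" x y] by (simp add: scaleC_minus_one)

lemma cinner_minus_right: "cinner x (- y) = - cinner x y"
  by (metis cinner_commute cinner_scaleC_left complex_cnj_minus complex_cnj_mult
      complex_cnj_one mult_minus1 scaleC_minus_one)

end

lemma cinner_diff_left: "cinner (x - y) z = cinner x z - cinner y z"
  using cinner_add_left[of x "- y" z] by (simp add: cinner_minus_left)

lemma cinner_diff_right: "cinner x (y - z) = cinner x y - cinner x z"
  using cinner_add_right[of x y "- z"] by (simp add: cinner_minus_right)

text \<open>Conjugate symmetry forces \<open>cinner x x\<close> to be real. Squared norms can
  therefore be computed inside complex identities and read off again by injectivity of
  \<open>complex_of_real\<close>.\<close>

lemma cinner_self: "cinner x x = complex_of_real ((cnorm x)\<^sup>2)"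
proof -
  have "Im (cinner x x) = 0"
    using cinner_commute[of x x] by (metis Reals_cnj_iff complex_is_Real_iff)
  then show ?thesis
    by (simp add: complex_eq_iff cnorm_def cinner_nonneg)
qed

lemma cnorm_ge_0 [simp]: "0 \<le> cnorm x"
  by (simp add: cnorm_def cinner_nonneg)

lemma cnorm_eq_0_iff [simp]: "cnorm x = 0 \<longleftrightarrow> x = 0"
proof
  assume "cnorm x = 0"
  then show "x = 0"
    using cinner_self[of x] cinner_eq_zero by simp
qed (simp add: cnorm_def)

lemma cnorm_zero [simp]: "cnorm 0 = 0"
  by simp

lemma cnorm_minus_commute: "cnorm (x - y) = cnorm (y - x)"
proof -
  have "cinner (x - y) (x - y) = cinner (y - x) (y - x)"
    by (simp add: cinner_diff_left cinner_diff_right)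
  then show ?thesis
    by (simp add: cnorm_def)
qed

lemma cnorm_scaleC: "cnorm (c *\<^sub>C x) = cmod c * cnorm x"
proof -
  have "cinner (c *\<^sub>C x) (c *\<^sub>C x) = (c * cnj c) * cinner x x"
    by (simp add: cinner_scaleC_left cinner_scaleC_right)
  also have "\<dots> = complex_of_real ((cmod c * cnorm x)\<^sup>2)"
    by (simp add: cinner_self complex_norm_square[symmetric] power_mult_distrib del: of_real_power)
  finally have "(cnorm (c *\<^sub>C x))\<^sup>2 = (cmod c * cnorm x)\<^sup>2"
    by (simp only: cinner_self of_real_eq_iff)
  then show ?thesis
    by (rule power2_eq_imp_eq) simp_all
qed

lemma cauchy_schwarz: "cmod (cinner x y) \<le> cnorm x * cnorm y"
proof (cases "y = 0")
  case False
  define d where "d = (cnorm y)\<^sup>2"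
  have d: "d > 0"
    using False by (simp add: d_def)
  define a where "a = cinner x y"
  have yx: "cinner y x = cnj a"
    using cinner_commute[of y x] by (simp add: a_def)
  \<comment> \<open>This is the coefficient of the orthogonal projection of \<open>x\<close> onto
    the line through \<open>y\<close>; expanding the nonnegative square of the residual
    \<open>x - c y\<close> gives the inequality.\<close>
  define c where "c = a / complex_of_real d"
  have "cinner (x - c *\<^sub>C y) (x - c *\<^sub>C y)
      = cinner x x - cnj c * a - c * cnj a + c * cnj c * cinner y y"
    using yx by (simp add: cinner_diff_left cinner_diff_right cinner_scaleC_left
        cinner_scaleC_right a_def algebra_simps)
  also have "\<dots> = complex_of_real ((cnorm x)\<^sup>2) - cnj c * a - c * cnj a
      + c * cnj c * complex_of_real d"
    by (simp only: cinner_self d_def)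
  also have "\<dots> = complex_of_real ((cnorm x)\<^sup>2) - (a * cnj a) / complex_of_real d"
    using d by (simp add: c_def field_simps)
  also have "\<dots> = complex_of_real ((cnorm x)\<^sup>2 - (cmod a)\<^sup>2 / d)"
    by (simp add: complex_norm_square[symmetric] del: of_real_power)
  finally have "0 \<le> (cnorm x)\<^sup>2 - (cmod a)\<^sup>2 / d"
    using cinner_nonneg[of "x - c *\<^sub>C y"] by simp
  then have "(cmod a)\<^sup>2 \<le> (cnorm x * cnorm y)\<^sup>2"
    using d by (simp add: field_simps power_mult_distrib flip: d_def)
  then show ?thesis
    unfolding a_def by (rule power2_le_imp_le) simp
qed simp

lemma cnorm_triangle: "cnorm (x + y) \<le> cnorm x + cnorm y"
proof -
  have "cinner (x + y) (x + y) = cinner x x + cinner y y + (cinner x y + cnj (cinner x y))"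
    by (simp add: cinner_add_left cinner_add_right cinner_commute[of y x])
  then have "complex_of_real ((cnorm (x + y))\<^sup>2)
      = complex_of_real ((cnorm x)\<^sup>2 + (cnorm y)\<^sup>2 + 2 * Re (cinner x y))"
    by (simp add: cinner_self complex_add_cnj)
  then have "(cnorm (x + y))\<^sup>2 = (cnorm x)\<^sup>2 + (cnorm y)\<^sup>2 + 2 * Re (cinner x y)"
    by (simp only: of_real_eq_iff)
  also have "\<dots> \<le> (cnorm x)\<^sup>2 + (cnorm y)\<^sup>2 + 2 * (cnorm x * cnorm y)"
    using cauchy_schwarz[of x y] complex_Re_le_cmod[of "cinner x y"] by linarith
  also have "\<dots> = (cnorm x + cnorm y)\<^sup>2"
    by (simp add: power2_sum)
  finally show ?thesis
    by (rule power2_le_imp_le) simp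
qed

lemma cnorm_triangle_diff: "cnorm (x - z) \<le> cnorm (x - y) + cnorm (y - z)"
  using cnorm_triangle[of "x - y" "y - z"] by simp

section \<open>Norm convergence, closures and total sets\<close>

definition ctendsto :: "(nat \<Rightarrow> 'h::complex_hilbert_space) \<Rightarrow> 'h \<Rightarrow> bool" where
  "ctendsto X x \<longleftrightarrow> (\<lambda>n. cnorm (X n - x)) \<longlonglongrightarrow> 0"

lemma ctendsto_const: "ctendsto (\<lambda>_. x) x"
  by (simp add: ctendsto_def)

lemma ctendsto_add:
  assumes "ctendsto X x" "ctendsto Y y"
  shows "ctendsto (\<lambda>n. X n + Y n) (x + y)"
  unfolding ctendsto_def
proof (rule tendsto_sandwich[of "\<lambda>_. 0"])
  show "\<forall>\<^sub>F n in sequentially. cnorm (X n + Y n - (x + y)) \<le> cnorm (X n - x) + cnorm (Y n - y)"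
    by (intro always_eventually allI) (metis add_diff_add cnorm_triangle)
  show "(\<lambda>n. cnorm (X n - x) + cnorm (Y n - y)) \<longlonglongrightarrow> 0"
    using tendsto_add[OF assms[unfolded ctendsto_def]] by simp
qed simp_all

lemma ctendsto_scaleC:
  assumes "ctendsto X x"
  shows "ctendsto (\<lambda>n. c *\<^sub>C X n) (c *\<^sub>C x)"
proof -
  have "c *\<^sub>C X n - c *\<^sub>C x = c *\<^sub>C (X n - x)" for n
    by (metis add_diff_cancel diff_add_cancel scaleC_add_right)
  then show ?thesis
    using tendsto_mult_left[OF assms[unfolded ctendsto_def], of "cmod c"]
    by (simp add: ctendsto_def cnorm_scaleC)
qed

lemma tendsto_cinner:
  assumes X: "ctendsto X x" and Y: "ctendsto Y y"
  shows "(\<lambda>n. cinner (X n) (Y n)) \<longlonglongrightarrow> cinner x y"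
proof (rule LIM_zero_cancel, rule Lim_null_comparison)
  let ?b = "\<lambda>n. cnorm (X n - x) * cnorm (Y n - y) + cnorm (X n - x) * cnorm y
      + cnorm x * cnorm (Y n - y)"
  \<comment> \<open>Expanding both slots around the limits leaves only fixed factors and factors
    tending to 0, so no separate bound on the sequences is required.\<close>
  have "cinner (X n) (Y n) - cinner x y
      = cinner (X n - x) (Y n - y) + cinner (X n - x) y + cinner x (Y n - y)" for n
    by (simp add: cinner_diff_left cinner_diff_right)
  then have "cmod (cinner (X n) (Y n) - cinner x y) \<le> ?b n" for n
    by (metis (no_types) add_mono cauchy_schwarz norm_triangle_le)
  then show "\<forall>\<^sub>F n in sequentially. cmod (cinner (X n) (Y n) - cinner x y) \<le> ?b n"
    by simp
  show "?b \<longlonglongrightarrow> 0"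
    using X Y unfolding ctendsto_def by (auto intro!: tendsto_eq_intros)
qed

lemma closure_C_sequence:
  assumes "x \<in> closure_C S"
  obtains X where "\<And>n. X n \<in> S" "ctendsto X x"
proof -
  have "\<forall>n::nat. \<exists>y\<in>S. cnorm (x - y) < 1 / real (Suc n)"
    using assms by (simp add: closure_C_def)
  then obtain X where X: "\<And>n. X n \<in> S" "\<And>n. cnorm (x - X n) < 1 / real (Suc n)"
    by metis
  have "ctendsto X x"
    unfolding ctendsto_def
  proof (rule tendsto_sandwich[of "\<lambda>_. 0"])
    show "\<forall>\<^sub>F n in sequentially. cnorm (X n - x) \<le> 1 / real (Suc n)"
      using X(2) by (simp add: cnorm_minus_commute[of _ x] less_imp_le)
    show "(\<lambda>n. 1 / real (Suc n)) \<longlonglongrightarrow> 0"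
      using LIMSEQ_inverse_real_of_nat by (simp add: divide_inverse)
  qed simp_all
  with X(1) show ?thesis
    using that by blast
qed

lemma closure_C_mono: "S \<subseteq> T \<Longrightarrow> closure_C S \<subseteq> closure_C T"
  unfolding closure_C_def by blast

lemma closure_C_closure_C: "closure_C (closure_C S) = closure_C S"
proof
  show "closure_C (closure_C S) \<subseteq> closure_C S"
  proof
    fix x assume x: "x \<in> closure_C (closure_C S)"
    show "x \<in> closure_C S"
      unfolding closure_C_def
    proof (intro CollectI allI impI)
      fix e :: real assume "e > 0"
      then obtain y where y: "y \<in> closure_C S" "cnorm (x - y) < e / 2"
        using x unfolding closure_C_def by (auto dest: spec[of _ "e / 2"])
      then obtain s where "s \<in> S" "cnorm (y - s) < e / 2"
        using \<open>e > 0\<close> unfolding closure_C_def by (auto dest: spec[of _ "e / 2"])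
      with y show "\<exists>s\<in>S. cnorm (x - s) < e"
        using cnorm_triangle_diff[of x s y] by force
    qed
  qed
  show "closure_C S \<subseteq> closure_C (closure_C S)"
  proof (rule closure_C_mono, rule subsetI)
    fix x assume "x \<in> S"
    then show "x \<in> closure_C S"
      unfolding closure_C_def by (auto intro!: bexI[of _ x])
  qed
qed

lemma lin_span_C_mono: "S \<subseteq> T \<Longrightarrow> lin_span_C S \<subseteq> lin_span_C T"
  unfolding lin_span_C_def by blast

text \<open>By totality \<open>x\<close> is itself a limit of combinations of \<open>S\<close>, all
  orthogonal to \<open>x\<close>; hence \<open>cinner x x\<close> is a limit of zeros.\<close>

lemma orthogonal_to_total_eq_0:
  assumes total: "closure_C (lin_span_C S) = UNIV"
    and orth: "\<And>s. s \<in> S \<Longrightarrow> cinner x s = 0"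
  shows "x = 0"
proof -
  obtain X where X: "\<And>n. X n \<in> lin_span_C S" "ctendsto X x"
    using closure_C_sequence[of x "lin_span_C S"] total by auto
  have sum: "cinner x (\<Sum>i<(n::nat). c i *\<^sub>C v i) = 0" if "\<forall>i<n. v i \<in> S" for n c v
    using that by (induction n) (auto simp: cinner_add_right cinner_scaleC_right orth)
  have "cinner x (X n) = 0" for n
    using X(1)[of n] sum by (auto simp: lin_span_C_def)
  moreover have "(\<lambda>n. cinner x (X n)) \<longlonglongrightarrow> cinner x x"
    by (rule tendsto_cinner[OF ctendsto_const X(2)])
  ultimately have "cinner x x = 0"
    by (simp add: LIMSEQ_const_iff eq_commute[of 0])
  then show ?thesis
    by (rule cinner_eq_zero)
qed

lemma eq_if_cinner_eq_on_total:
  assumes "closure_C (lin_span_C S) = UNIV"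
    and "\<And>s. s \<in> S \<Longrightarrow> cinner x s = cinner y s"
  shows "x = y"
  using orthogonal_to_total_eq_0[of S "x - y"] assms by (simp add: cinner_diff_left)

lemma clinear_on_UNIV_sum:
  assumes "clinear_on UNIV U"
  shows "U (\<Sum>i<(n::nat). c i *\<^sub>C v i) = (\<Sum>i<n. c i *\<^sub>C U (v i))"
proof (induction n)
  case 0
  show ?case
    using assms scaleC_zero_left[of "0::'a"] scaleC_zero_left[of "U 0"]
    unfolding clinear_on_def by (metis UNIV_I lessThan_0 sum.empty)
qed (use assms in \<open>auto simp: clinear_on_def\<close>)

lemma cunitary_diff: "cunitary U \<Longrightarrow> U (x - y) = U x - U y"
  unfolding cunitary_def clinear_on_def by (metis UNIV_I add_diff_cancel diff_add_cancel)

text \<open>Linearity handles the spans, and since \<open>U\<close> preserves distances, the image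
  of an approximant approximates equally well. This later carries each level of the first dilation
  space into the same level of the second.\<close>

lemma cunitary_image_closure_span:
  assumes U: "cunitary U" and img: "U ` S \<subseteq> T"
  shows "U ` closure_C (lin_span_C S) \<subseteq> closure_C (lin_span_C T)"
proof (intro image_subsetI)
  fix x assume x: "x \<in> closure_C (lin_span_C S)"
  have span: "U s \<in> lin_span_C T" if s: "s \<in> lin_span_C S" for s
  proof -
    obtain n :: nat and c v where "\<forall>i<n. v i \<in> S" "s = (\<Sum>i<n. c i *\<^sub>C v i)"
      using s unfolding lin_span_C_def by blast
    then show ?thesis
      using img clinear_on_UNIV_sum[of U] U unfolding lin_span_C_def cunitary_def
      by (auto intro!: exI[of _ n] exI[of _ c] exI[of _ "\<lambda>i. U (v i)"])
  qed
  have "cnorm (U x - U s) = cnorm (x - s)" for s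
    using U by (simp add: cunitary_diff[OF U, symmetric]) (simp add: cunitary_def cnorm_def)
  then show "U x \<in> closure_C (lin_span_C T)"
    using x span unfolding closure_C_def by (auto simp: Bex_def) metis
qed

section \<open>Total families with the same Gram matrix\<close>

text \<open>The span of the pairs \<open>(u i, v i)\<close> in the product space. Working with a
  linear relation postpones the question whether sending \<open>u i\<close> to \<open>v i\<close>
  extends to a well-defined map until the Gram hypothesis can settle it.\<close>

inductive_set joint_span ::
  "('i \<Rightarrow> 'k1::complex_vector_space) \<Rightarrow> ('i \<Rightarrow> 'k2::complex_vector_space) \<Rightarrow> 'i set \<Rightarrow> ('k1 \<times> 'k2) set"
  for u v I where
  zero: "(0, 0) \<in> joint_span u v I"
| gen: "i \<in> I \<Longrightarrow> (u i, v i) \<in> joint_span u v I"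
| add: "(x, y) \<in> joint_span u v I \<Longrightarrow> (x', y') \<in> joint_span u v I \<Longrightarrow>
    (x + x', y + y') \<in> joint_span u v I"
| scale: "(x, y) \<in> joint_span u v I \<Longrightarrow> (c *\<^sub>C x, c *\<^sub>C y) \<in> joint_span u v I"

lemma joint_span_diff:
  assumes "(x, y) \<in> joint_span u v I" "(x', y') \<in> joint_span u v I"
  shows "(x - x', y - y') \<in> joint_span u v I"
  using joint_span.add[OF assms(1) joint_span.scale[OF assms(2), of "-1"]]
  by (simp add: scaleC_minus_one)

lemma joint_span_swap: "(x, y) \<in> joint_span u v I \<Longrightarrow> (y, x) \<in> joint_span v u I"
  by (induction rule: joint_span.induct) (auto intro: joint_span.intros)

text \<open>The partner \<open>y\<close> is the combination of the \<open>v i\<close> with the same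
  coefficients, built along the induction on the number of summands.\<close>

lemma lin_span_C_lift_joint_span:
  assumes "x \<in> lin_span_C (u ` I)"
  obtains y where "(x, y) \<in> joint_span u v I"
proof -
  have "\<exists>y. ((\<Sum>i<(n::nat). c i *\<^sub>C w i), y) \<in> joint_span u v I" if "\<forall>i<n. w i \<in> u ` I" for n c w
    using that
  proof (induction n)
    case 0
    then show ?case
      using joint_span.zero by auto
  next
    case (Suc n)
    then obtain y where y: "((\<Sum>i<n. c i *\<^sub>C w i), y) \<in> joint_span u v I"
      by auto
    obtain i where i: "i \<in> I" "w n = u i"
      using Suc.prems by auto
    show ?case
      using joint_span.add[OF y joint_span.scale[OF joint_span.gen[OF i(1)], of "c n"]] i(2)
      by auto
  qed
  then show ?thesis
    using assms that unfolding lin_span_C_def by blast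
qed

text \<open>The sequential closure of that relation in the product space. With equal Gram matrices
  and both families total, it is the graph of the unitary sought.\<close>

definition joint_closure ::
  "('i \<Rightarrow> 'k1::complex_hilbert_space) \<Rightarrow> ('i \<Rightarrow> 'k2::complex_hilbert_space) \<Rightarrow> 'i set \<Rightarrow> 'k1 \<Rightarrow> 'k2 \<Rightarrow> bool"
  where "joint_closure u v I x y \<longleftrightarrow>
    (\<exists>X Y. (\<forall>n. (X n, Y n) \<in> joint_span u v I) \<and> ctendsto X x \<and> ctendsto Y y)"

lemma joint_closure_swap: "joint_closure u v I x y \<Longrightarrow> joint_closure v u I y x"
  unfolding joint_closure_def using joint_span_swap by metis

lemma joint_closure_gen: "i \<in> I \<Longrightarrow> joint_closure u v I (u i) (v i)"
  unfolding joint_closure_def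
  by (intro exI[of _ "\<lambda>_. u i"] exI[of _ "\<lambda>_. v i"]) (simp add: ctendsto_const joint_span.gen)

lemma joint_closure_add:
  assumes "joint_closure u v I x y" "joint_closure u v I x' y'"
  shows "joint_closure u v I (x + x') (y + y')"
proof -
  obtain X Y X' Y' where "\<forall>n. (X n, Y n) \<in> joint_span u v I" "ctendsto X x" "ctendsto Y y"
      "\<forall>n. (X' n, Y' n) \<in> joint_span u v I" "ctendsto X' x'" "ctendsto Y' y'"
    using assms unfolding joint_closure_def by blast
  then show ?thesis
    unfolding joint_closure_def
    by (intro exI[of _ "\<lambda>n. X n + X' n"] exI[of _ "\<lambda>n. Y n + Y' n"])
      (simp add: joint_span.add ctendsto_add)
qed

lemma joint_closure_scaleC:
  assumes "joint_closure u v I x y"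
  shows "joint_closure u v I (c *\<^sub>C x) (c *\<^sub>C y)"
proof -
  obtain X Y where "\<forall>n. (X n, Y n) \<in> joint_span u v I" "ctendsto X x" "ctendsto Y y"
    using assms unfolding joint_closure_def by blast
  then show ?thesis
    unfolding joint_closure_def
    by (intro exI[of _ "\<lambda>n. c *\<^sub>C X n"] exI[of _ "\<lambda>n. c *\<^sub>C Y n"])
      (simp add: joint_span.scale ctendsto_scaleC)
qed

context
  fixes u :: "'i \<Rightarrow> 'k1::complex_hilbert_space" and v :: "'i \<Rightarrow> 'k2::complex_hilbert_space" and I :: "'i set"
  assumes gram: "\<And>i j. i \<in> I \<Longrightarrow> j \<in> I \<Longrightarrow> cinner (u i) (u j) = cinner (v i) (v j)"
begin

lemma joint_span_cinner_gen:
  assumes "(x, y) \<in> joint_span u v I" "j \<in> I"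
  shows "cinner x (u j) = cinner y (v j)"
  using assms by (induction rule: joint_span.induct) (auto simp: gram cinner_add_left cinner_scaleC_left)

lemma joint_span_cinner:
  assumes "(x, y) \<in> joint_span u v I" "(x', y') \<in> joint_span u v I"
  shows "cinner x x' = cinner y y'"
  \<comment> \<open>The second pair comes first so that the induction runs on it; its generator case
    is the preceding lemma.\<close>
  using assms(2,1)
  by (induction rule: joint_span.induct)
    (auto simp: joint_span_cinner_gen cinner_add_right cinner_scaleC_right)

lemma joint_span_cnorm: "(x, y) \<in> joint_span u v I \<Longrightarrow> cnorm x = cnorm y"
  by (simp add: cnorm_def joint_span_cinner)

lemma joint_closure_cinner:
  assumes "joint_closure u v I x y" "joint_closure u v I x' y'"
  shows "cinner x x' = cinner y y'"
proof -
  obtain X Y X' Y' where *: "\<forall>n. (X n, Y n) \<in> joint_span u v I" "ctendsto X x" "ctendsto Y y"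
      "\<forall>n. (X' n, Y' n) \<in> joint_span u v I" "ctendsto X' x'" "ctendsto Y' y'"
    using assms unfolding joint_closure_def by blast
  have "(\<lambda>n. cinner (X n) (X' n)) = (\<lambda>n. cinner (Y n) (Y' n))"
    using * joint_span_cinner by blast
  then show ?thesis
    using tendsto_cinner[OF *(2,5)] tendsto_cinner[OF *(3,6)] LIMSEQ_unique by metis
qed

lemma joint_closure_total:
  assumes "x \<in> closure_C (lin_span_C (u ` I))"
  obtains y where "joint_closure u v I x y"
proof -
  obtain X where X: "\<And>n. X n \<in> lin_span_C (u ` I)" "ctendsto X x"
    using closure_C_sequence[OF assms] by blast
  have "\<forall>n. \<exists>y. (X n, y) \<in> joint_span u v I"
    using X(1) lin_span_C_lift_joint_span by metis
  then obtain Y where Y: "\<And>n. (X n, Y n) \<in> joint_span u v I"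
    by metis
  \<comment> \<open>Differences of related vectors are related and thus have equal norms, so
    \<open>Y\<close> inherits the Cauchy property from the convergent \<open>X\<close>; completeness
    of the second space then supplies \<open>y\<close>.\<close>
  have "\<exists>N::nat. \<forall>i\<ge>N. \<forall>j\<ge>N. cnorm (Y i - Y j) < e" if "e > 0" for e
  proof -
    obtain N where N: "\<And>n. n \<ge> N \<Longrightarrow> cnorm (X n - x) < e / 2"
      using X(2) \<open>e > 0\<close> unfolding ctendsto_def LIMSEQ_iff
      by (metis abs_of_nonneg cnorm_ge_0 diff_zero half_gt_zero real_norm_def)
    have "cnorm (Y i - Y j) < e" if "i \<ge> N" "j \<ge> N" for i j
    proof -
      have "cnorm (Y i - Y j) = cnorm (X i - X j)"
        using joint_span_cnorm[OF joint_span_diff[OF Y[of i] Y[of j]]] by simp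
      also have "\<dots> \<le> cnorm (X i - x) + cnorm (X j - x)"
        using cnorm_triangle_diff[of "X i" "X j" x] by (simp add: cnorm_minus_commute[of x])
      also have "\<dots> < e"
        using N[OF that(1)] N[OF that(2)] by simp
      finally show ?thesis .
    qed
    then show ?thesis
      by blast
  qed
  then obtain y where "\<forall>e>0. \<exists>N::nat. \<forall>i\<ge>N. cnorm (Y i - y) < e"
    using cinner_complete[of Y] unfolding cnorm_def by blast
  then have "ctendsto Y y"
    by (simp add: ctendsto_def LIMSEQ_iff)
  with X(2) Y have "joint_closure u v I x y"
    unfolding joint_closure_def by blast
  then show ?thesis
    using that by blast
qed

end

text \<open>The closed relation is defined everywhere because the \<open>u i\<close> are total, and
  single-valued because the \<open>v i\<close> are. Preservation of inner products is inherited from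
  the relation.\<close>

lemma unitary_of_equal_gram:
  fixes u :: "'i \<Rightarrow> 'k1::complex_hilbert_space" and v :: "'i \<Rightarrow> 'k2::complex_hilbert_space"
  assumes gram: "\<And>i j. i \<in> I \<Longrightarrow> j \<in> I \<Longrightarrow> cinner (u i) (u j) = cinner (v i) (v j)"
    and total_u: "closure_C (lin_span_C (u ` I)) = UNIV"
    and total_v: "closure_C (lin_span_C (v ` I)) = UNIV"
  obtains U where "cunitary U" "\<And>i. i \<in> I \<Longrightarrow> U (u i) = v i"
proof -
  let ?R = "joint_closure u v I"
  have inner: "cinner x x' = cinner y y'" if "?R x y" "?R x' y'" for x y x' y'
    using joint_closure_cinner[of I u v] gram that by blast
  have "\<exists>y. ?R x y" for x
    using joint_closure_total[of I u v x] gram total_u by (metis UNIV_I)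
  then obtain U where U: "\<And>x. ?R x (U x)"
    by metis
  \<comment> \<open>Any partner of \<open>x\<close> has inner product \<open>cinner x (u i)\<close>
    with \<open>v i\<close>, and the total family \<open>v\<close> separates vectors. Linearity of
    \<open>U\<close> follows too, since sums and multiples of related pairs are related.\<close>
  have unique: "U x = y" if "?R x y" for x y
  proof (rule eq_if_cinner_eq_on_total[OF total_v])
    fix s assume "s \<in> v ` I"
    then obtain i where "i \<in> I" "s = v i"
      by blast
    then show "cinner (U x) s = cinner y s"
      using inner[OF U joint_closure_gen] inner[OF that joint_closure_gen] by metis
  qed
  have "surj U"
    unfolding surj_def
  proof
    \<comment> \<open>The Gram hypothesis is symmetric in the two families, so the totality lemma
      with \<open>u\<close> and \<open>v\<close> exchanged yields a preimage.\<close>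
    fix y
    obtain x where "joint_closure v u I y x"
      using joint_closure_total[of I v u y] gram total_v by (metis UNIV_I)
    then show "\<exists>x. y = U x"
      using unique joint_closure_swap by metis
  qed
  moreover have "clinear_on UNIV U"
    unfolding clinear_on_def using unique U joint_closure_add joint_closure_scaleC by blast
  moreover have "cinner (U x) (U y) = cinner x y" for x y
    using inner[OF U U] by simp
  ultimately have "cunitary U"
    by (simp add: cunitary_def)
  moreover have "U (u i) = v i" if "i \<in> I" for i
    using unique joint_closure_gen[OF that] by metis
  ultimately show ?thesis
    using that by blast
qed

section \<open>Commuting representations\<close>

text \<open>The operators are controlled only on their domain \<open>G\<close>, so every law is
  restricted to it; \<open>closed\<close> keeps iterated products inside \<open>G\<close>, where the
  laws can be applied again.\<close>

locale commuting_star_homs =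
  fixes G :: "'k::complex_hilbert_space set" and m :: nat and \<pi> :: "nat \<Rightarrow> 'a::complex_star_algebra \<Rightarrow> 'k \<Rightarrow> 'k"
  assumes closed: "q \<in> {1..m} \<Longrightarrow> x \<in> G \<Longrightarrow> \<pi> q a x \<in> G"
    and mult: "q \<in> {1..m} \<Longrightarrow> x \<in> G \<Longrightarrow> \<pi> q (a * b) x = \<pi> q a (\<pi> q b x)"
    and adjoint: "q \<in> {1..m} \<Longrightarrow> x \<in> G \<Longrightarrow> y \<in> G \<Longrightarrow>
      cinner (\<pi> q a x) y = cinner x (\<pi> q (cstar a) y)"
    and commute: "q \<in> {1..m} \<Longrightarrow> q' \<in> {1..m} \<Longrightarrow> q \<noteq> q' \<Longrightarrow> x \<in> G \<Longrightarrow>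
      \<pi> q a (\<pi> q' b x) = \<pi> q' b (\<pi> q a x)"
begin

lemma pi_prod_closed: "j \<le> m \<Longrightarrow> x \<in> G \<Longrightarrow> pi_prod \<pi> b j x \<in> G"
  by (induction j arbitrary: x) (auto simp: closed)

text \<open>The condition \<open>j < q\<close> makes every index in the product different from
  \<open>q\<close>, as the commutation law demands.\<close>

lemma pi_prod_commute:
  "j < q \<Longrightarrow> q \<le> m \<Longrightarrow> x \<in> G \<Longrightarrow> \<pi> q a (pi_prod \<pi> b j x) = pi_prod \<pi> b j (\<pi> q a x)"
  by (induction j arbitrary: x) (auto simp: closed commute)

text \<open>At each step the last factor of the left product slides past the shorter right product
  and meets its partner with the same index, where multiplicativity merges them.\<close>

lemma pi_prod_mult:
  "j \<le> m \<Longrightarrow> x \<in> G \<Longrightarrow> pi_prod \<pi> b j (pi_prod \<pi> c j x) = pi_prod \<pi> (\<lambda>q. b q * c q) j x"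
  by (induction j arbitrary: x) (auto simp: closed mult pi_prod_commute)

text \<open>Taking adjoints reverses the order of the factors; commutativity puts them back in
  increasing order.\<close>

lemma pi_prod_adjoint:
  "j \<le> m \<Longrightarrow> x \<in> G \<Longrightarrow> y \<in> G \<Longrightarrow>
    cinner (pi_prod \<pi> b j x) y = cinner x (pi_prod \<pi> (\<lambda>q. cstar (b q)) j y)"
  by (induction j arbitrary: x y) (auto simp: closed adjoint pi_prod_closed pi_prod_commute)

end

lemma pi_prod_cong: "(\<And>q. q \<in> {1..j} \<Longrightarrow> b q = c q) \<Longrightarrow> pi_prod \<pi> b j x = pi_prod \<pi> c j x"
  by (induction j arbitrary: x) auto

section \<open>Consequences of the Stinespring formula and of minimality\<close>

lemma stinespring_commuting_star_homs:
  assumes "stinespring_triple Lam p Om le E k \<phi> \<pi> V F"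
  shows "commuting_star_homs (qdom Om F) ((k + 1) div 2) \<pi>"
proof -
  have hom: "local_contr_star_hom Lam p Om F (\<pi> q)" if "q \<in> {1..(k + 1) div 2}" for q
    using assms that by (simp add: stinespring_triple_def)
  show ?thesis
  proof
    fix q x a assume "q \<in> {1..(k + 1) div 2}" "x \<in> qdom Om F"
    then show "\<pi> q a x \<in> qdom Om F"
      using hom[of q] unfolding local_contr_star_hom_def cstar_ED_def by simp
  next
    fix q x a b assume "q \<in> {1..(k + 1) div 2}" "x \<in> qdom Om F"
    then show "\<pi> q (a * b) x = \<pi> q a (\<pi> q b x)"
      using hom[of q] unfolding local_contr_star_hom_def by blast
  next
    fix q x y a assume "q \<in> {1..(k + 1) div 2}" "x \<in> qdom Om F" "y \<in> qdom Om F"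
    then show "cinner (\<pi> q a x) y = cinner x (\<pi> q (cstar a) y)"
      using hom[of q] unfolding local_contr_star_hom_def op_adjoint_on_def by blast
  next
    fix q q' x a b
    assume "q \<in> {1..(k + 1) div 2}" "q' \<in> {1..(k + 1) div 2}" "q \<noteq> q'" "x \<in> qdom Om F"
    then show "\<pi> q a (\<pi> q' b x) = \<pi> q' b (\<pi> q a x)"
      using assms unfolding stinespring_triple_def by blast
  qed
qed

lemma stinespring_V_in_qdom:
  assumes "stinespring_triple Lam p Om le E k \<phi> \<pi> V F" "h \<in> qdom Om E"
  shows "V h \<in> qdom Om F"
  using assms unfolding stinespring_triple_def qdom_def by blast

text \<open>The formula only involves tuples of the form \<open>stine_args k a\<close>; the unit of
  the algebra shows that every tuple \<open>b\<close> arises in this way, so the formula covers all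
  products of representations.\<close>

lemma stine_args_surj:
  obtains a where "\<And>q. q \<in> {1..(k + 1) div 2} \<Longrightarrow> stine_args k a q = b q"
proof -
  define m where "m = (k + 1) div 2"
  \<comment> \<open>Each product gets 1 as left factor and \<open>b q\<close> as right factor. For
    odd \<open>k\<close> the middle entry stands alone and must carry \<open>b 1\<close>, whence the
    strict bound \<open>t < m\<close> there and the shift by one.\<close>
  define a where "a t = (if odd k then if t < m then 1 else b (t + 1 - m)
      else if t \<le> m then 1 else b (t - m))" for t
  have "stine_args k a q = b q" if "q \<in> {1..m}" for q
    using that unfolding stine_args_def Let_def m_def[symmetric] a_def by auto
  then show ?thesis
    using that unfolding m_def by blast
qed

lemma stinespring_cinner_V:
  assumes "stinespring_triple Lam p Om le E k \<phi> \<pi> V F" "h \<in> qdom Om E"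
    and "\<And>q. q \<in> {1..(k + 1) div 2} \<Longrightarrow> stine_args k a q = b q"
  shows "cinner (pi_prod \<pi> b ((k + 1) div 2) (V h)) (V z) = cinner (\<phi> a h) z"
proof -
  have "pi_prod \<pi> b ((k + 1) div 2) (V h) = pi_prod \<pi> (stine_args k a) ((k + 1) div 2) (V h)"
    using assms(3) by (intro pi_prod_cong) simp
  then show ?thesis
    using assms(1,2) unfolding stinespring_triple_def by simp
qed

text \<open>Both sides equal \<open>cinner\<close> of \<open>\<phi> a h\<close> with
  \<open>z\<close> for one \<open>a\<close> realizing \<open>b\<close>: this is how the common
  \<open>\<phi>\<close> ties the two triples together. Here \<open>z\<close> ranges over the whole
  Hilbert space.\<close>

lemma stinespring_cinner_V_unique:
  assumes "stinespring_triple Lam p Om le E k \<phi> \<pi>1 V1 F1"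
    and "stinespring_triple Lam p Om le E k \<phi> \<pi>2 V2 F2" and "h \<in> qdom Om E"
  shows "cinner (pi_prod \<pi>1 b ((k + 1) div 2) (V1 h)) (V1 z)
    = cinner (pi_prod \<pi>2 b ((k + 1) div 2) (V2 h)) (V2 z)"
proof -
  obtain a where "\<And>q. q \<in> {1..(k + 1) div 2} \<Longrightarrow> stine_args k a q = b q"
    using stine_args_surj[of k b] by blast
  then show ?thesis
    using stinespring_cinner_V[OF assms(1,3)] stinespring_cinner_V[OF assms(2,3)] by metis
qed

text \<open>Moving the second product to the left leaves a bare \<open>V h'\<close> on the right,
  which is the shape the Stinespring formula evaluates.\<close>

lemma stinespring_gram:
  assumes T: "stinespring_triple Lam p Om le E k \<phi> \<pi> V F"
    and h: "h \<in> qdom Om E" "h' \<in> qdom Om E"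
  shows "cinner (pi_prod \<pi> b ((k + 1) div 2) (V h)) (pi_prod \<pi> c ((k + 1) div 2) (V h'))
    = cinner (pi_prod \<pi> (\<lambda>q. cstar (c q) * b q) ((k + 1) div 2) (V h)) (V h')"
proof -
  interpret commuting_star_homs "qdom Om F" "(k + 1) div 2" \<pi>
    by (rule stinespring_commuting_star_homs[OF T])
  have V: "V h \<in> qdom Om F" "V h' \<in> qdom Om F"
    using stinespring_V_in_qdom[OF T] h by auto
  \<comment> \<open>The double star puts the right-hand product in the form in which
    \<open>pi_prod_adjoint\<close> can be read from right to left.\<close>
  have "pi_prod \<pi> c ((k + 1) div 2) (V h')
      = pi_prod \<pi> (\<lambda>q. cstar (cstar (c q))) ((k + 1) div 2) (V h')"
    by (simp add: cstar_cstar)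
  then show ?thesis
    using V by (simp add: pi_prod_adjoint[symmetric] pi_prod_closed pi_prod_mult)
qed

text \<open>Minimality places every level \<open>F l\<close> in the closed span of the generators;
  the levels have dense union and closure is idempotent.\<close>

lemma minimal_stinespring_total:
  assumes "minimal_stinespring_triple Lam p Om le E k \<phi> \<pi> V F"
  shows "closure_C (lin_span_C ((\<lambda>(b, h). pi_prod \<pi> b ((k + 1) div 2) (V h)) ` (UNIV \<times> qdom Om E))) = UNIV"
    (is "closure_C ?S = UNIV")
proof -
  have "F l \<subseteq> closure_C ?S" if "l \<in> Om" for l
  proof -
    have "F l = closure_C (lin_span_C {pi_prod \<pi> b ((k + 1) div 2) (V h) | b h. h \<in> E l})"
      using assms that unfolding minimal_stinespring_triple_def by blast
    also have "\<dots> \<subseteq> closure_C ?S"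
      using that by (intro closure_C_mono lin_span_C_mono) (force simp: qdom_def)
    finally show ?thesis .
  qed
  then have "closure_C (qdom Om F) \<subseteq> closure_C (closure_C ?S)"
    unfolding qdom_def by (intro closure_C_mono) blast
  moreover have "closure_C (qdom Om F) = UNIV"
    using assms
    by (simp add: minimal_stinespring_triple_def stinespring_triple_def quantized_domain_def)
  ultimately show ?thesis
    unfolding closure_C_closure_C by blast
qed

theorem theorem4p4:
  fixes Lam :: "'i set" and p :: "'i \<Rightarrow> 'a::complex_star_algebra \<Rightarrow> real"
    and Om :: "'o set" and le :: "'o \<Rightarrow> 'o \<Rightarrow> bool"
    and E :: "'o \<Rightarrow> 'h::complex_hilbert_space set"
    and k :: nat and \<phi> :: "(nat \<Rightarrow> 'a) \<Rightarrow> 'h \<Rightarrow> 'h"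
    and \<pi>1 :: "nat \<Rightarrow> 'a \<Rightarrow> 'k1::complex_hilbert_space \<Rightarrow> 'k1" and V1 :: "'h \<Rightarrow> 'k1" and F1 :: "'o \<Rightarrow> 'k1 set"
    and \<pi>2 :: "nat \<Rightarrow> 'a \<Rightarrow> 'k2::complex_hilbert_space \<Rightarrow> 'k2" and V2 :: "'h \<Rightarrow> 'k2" and F2 :: "'o \<Rightarrow> 'k2 set"
  assumes "locally_cstar Lam p"
    and "quantized_domain Om le E"
    and "k \<ge> 1"
    and "ICPCC_s_loc Lam p Om E k \<phi>"
    and "minimal_stinespring_triple Lam p Om le E k \<phi> \<pi>1 V1 F1"
    and "minimal_stinespring_triple Lam p Om le E k \<phi> \<pi>2 V2 F2"
  shows "\<exists>U :: 'k1 \<Rightarrow> 'k2. cunitary U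
    \<and> (\<forall>h. U (V1 h) = V2 h)
    \<and> (\<forall>b. \<forall>x\<in>qdom Om F1. U x \<in> qdom Om F2
         \<and> U (pi_prod \<pi>1 b ((k + 1) div 2) x) = pi_prod \<pi>2 b ((k + 1) div 2) (U x))"
proof -
  let ?m = "(k + 1) div 2" and ?G1 = "qdom Om F1" and ?G2 = "qdom Om F2"
  let ?I = "(UNIV :: (nat \<Rightarrow> 'a) set) \<times> qdom Om E"
  \<comment> \<open>Both families are indexed by the same pairs \<open>(b, h)\<close>, so that their
    Gram matrices can be compared entry by entry.\<close>
  define w1 where "w1 = (\<lambda>(b, h). pi_prod \<pi>1 b ?m (V1 h))"
  define w2 where "w2 = (\<lambda>(b, h). pi_prod \<pi>2 b ?m (V2 h))"
  note min1 = assms(5) and min2 = assms(6)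
  have T1: "stinespring_triple Lam p Om le E k \<phi> \<pi>1 V1 F1"
    and T2: "stinespring_triple Lam p Om le E k \<phi> \<pi>2 V2 F2"
    using min1 min2 by (simp_all add: minimal_stinespring_triple_def)
  interpret S1: commuting_star_homs ?G1 ?m \<pi>1
    by (rule stinespring_commuting_star_homs[OF T1])
  interpret S2: commuting_star_homs ?G2 ?m \<pi>2
    by (rule stinespring_commuting_star_homs[OF T2])
  have V1G: "V1 h \<in> ?G1" and V2G: "V2 h \<in> ?G2" if "h \<in> qdom Om E" for h
    using stinespring_V_in_qdom[OF T1 that] stinespring_V_in_qdom[OF T2 that] .
  have total1: "closure_C (lin_span_C (w1 ` ?I)) = UNIV"
    and total2: "closure_C (lin_span_C (w2 ` ?I)) = UNIV"
    using minimal_stinespring_total[OF min1] minimal_stinespring_total[OF min2]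
    by (simp_all add: w1_def w2_def)
  have gram: "cinner (w1 i) (w1 j) = cinner (w2 i) (w2 j)" if "i \<in> ?I" "j \<in> ?I" for i j
    using that stinespring_gram[OF T1] stinespring_gram[OF T2] stinespring_cinner_V_unique[OF T1 T2]
    by (auto simp: w1_def w2_def)
  obtain U where U: "cunitary U" and Uw: "\<And>i. i \<in> ?I \<Longrightarrow> U (w1 i) = w2 i"
    using unitary_of_equal_gram[of ?I w1 w2, OF gram total1 total2] by blast
  have iso: "cinner (U x) (U y) = cinner x y" for x y
    using U by (simp add: cunitary_def)
  \<comment> \<open>The vector \<open>z\<close> need not lie in the domain \<open>qdom Om E\<close>,
    so \<open>V1 z\<close> need not be among the generators; it is identified through its inner
    products with them.\<close>
  have UV: "U (V1 z) = V2 z" for z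
  proof (rule eq_if_cinner_eq_on_total[OF total2])
    fix s assume "s \<in> w2 ` ?I"
    then obtain b h where h: "h \<in> qdom Om E" and s: "s = w2 (b, h)"
      by blast
    have "cinner s (U (V1 z)) = cinner (w1 (b, h)) (V1 z)"
      using Uw[of "(b, h)"] h iso[of "w1 (b, h)"] s by simp
    also have "\<dots> = cinner s (V2 z)"
      using stinespring_cinner_V_unique[OF T1 T2 h] by (simp add: s w1_def w2_def)
    finally show "cinner (U (V1 z)) s = cinner (V2 z) s"
      by (metis cinner_commute)
  qed
  \<comment> \<open>The domain is not closed, so the argument runs level by level: \<open>U\<close>
    sends the generators with \<open>h\<close> in \<open>E l\<close> to their counterparts, and
    minimality describes \<open>F1 l\<close> and \<open>F2 l\<close> by these.\<close>
  have UG: "U x \<in> ?G2" if x: "x \<in> ?G1" for x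
  proof -
    obtain l where l: "l \<in> Om" "x \<in> F1 l"
      using x by (auto simp: qdom_def)
    let ?S1 = "{pi_prod \<pi>1 b ?m (V1 h) | b h. h \<in> E l}"
    let ?S2 = "{pi_prod \<pi>2 b ?m (V2 h) | b h. h \<in> E l}"
    have "U ` ?S1 \<subseteq> ?S2"
    proof (intro image_subsetI)
      fix y assume "y \<in> ?S1"
      then obtain b h where h: "h \<in> E l" and y: "y = w1 (b, h)"
        by (auto simp: w1_def)
      have "U y = pi_prod \<pi>2 b ?m (V2 h)"
        using Uw[of "(b, h)"] h y l(1) by (auto simp: qdom_def w2_def)
      with h show "U y \<in> ?S2"
        by blast
    qed
    then have "U ` closure_C (lin_span_C ?S1) \<subseteq> closure_C (lin_span_C ?S2)"
      by (rule cunitary_image_closure_span[OF U])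
    moreover have "F1 l = closure_C (lin_span_C ?S1)" "F2 l = closure_C (lin_span_C ?S2)"
      using min1 min2 l(1) unfolding minimal_stinespring_triple_def by blast+
    ultimately have "U x \<in> F2 l"
      using l(2) by blast
    then show ?thesis
      using l(1) by (auto simp: qdom_def)
  qed
  have intertwine: "U (pi_prod \<pi>1 b ?m x) = pi_prod \<pi>2 b ?m (U x)" if x: "x \<in> ?G1" for b x
  proof (rule eq_if_cinner_eq_on_total[OF total2])
    fix s assume "s \<in> w2 ` ?I"
    then obtain c h where h: "h \<in> qdom Om E" and s: "s = w2 (c, h)"
      by blast
    \<comment> \<open>The tuple obtained when the adjoint of the product for \<open>b\<close> is
      absorbed into the generator with tuple \<open>c\<close>; the result is again a generator, on
      which \<open>U\<close> is known.\<close>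
    let ?c = "\<lambda>q. cstar (b q) * c q"
    have "cinner (U (pi_prod \<pi>1 b ?m x)) s = cinner (pi_prod \<pi>1 b ?m x) (w1 (c, h))"
      using Uw[of "(c, h)"] h iso[of _ "w1 (c, h)"] s by simp
    also have "\<dots> = cinner x (w1 (?c, h))"
      using x V1G[OF h] by (simp add: w1_def S1.pi_prod_adjoint S1.pi_prod_closed S1.pi_prod_mult)
    also have "\<dots> = cinner (U x) (w2 (?c, h))"
      using Uw[of "(?c, h)"] h iso[of x "w1 (?c, h)"] by simp
    \<comment> \<open>Undoing the absorption in the second triple uses the adjoint law at
      \<open>U x\<close>, which is available because \<open>UG\<close> places \<open>U x\<close> in
      the second domain.\<close>
    also have "\<dots> = cinner (pi_prod \<pi>2 b ?m (U x)) s"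
      using UG[OF x] V2G[OF h]
      by (simp add: s w2_def S2.pi_prod_adjoint S2.pi_prod_closed S2.pi_prod_mult)
    finally show "cinner (U (pi_prod \<pi>1 b ?m x)) s = cinner (pi_prod \<pi>2 b ?m (U x)) s" .
  qed
  show ?thesis
    using U UV UG intertwine by blast
qed

end
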